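(* Let $q,\upsilon,\gamma_1,\gamma_2,\gamma_3,\gamma_4,\tau,w\in\mathbb{C}$ with $\operatorname{Re}(q)>0$, $\operatorname{Re}(\upsilon)>0$, $\gamma_3,\gamma_4\notin\{0,-1,-2,\dots\}$, $\operatorname{Re}(\tau)\ge0$ and $\operatorname{Re}(q-\tau)\geq0$. Let $b\in\mathbb{R}$, $t>b$ and $-\tfrac14<z<\tfrac14$. Then $${}_{t}D_{b^{+}}^{\tau}\left[(t-b)^{q-1}E_{\gamma_{3},\gamma_{4};q;\upsilon}^{(\gamma_{1};\gamma_{2})}(z,w(t-b))\right]=(t-b)^{q-\tau-1}E_{\gamma_{3},\gamma_{4};q-\tau;\upsilon}^{(\gamma_{1};\gamma_{2})}(z,w(t-b)).$$
   Context: $(a)_n$ is the Pochhammer symbol. The bivariate I-Konhauser Mittag-Leffler function is $$E_{\gamma_{3},\gamma_{4};q;\upsilon}^{(\gamma_{1};\gamma_{2})}(z,t)=\sum_{l=0}^{\infty}\sum_{n=0}^{\infty}\frac{(-1)^{n}(\gamma_{1})_{2n}(\gamma_{2})_{l+n}\,z^{n}t^{\upsilon l}}{(\gamma_{3})_{n}(\gamma_{4})_{n}\,\Gamma(q+\upsilon l)\,n!\,l!},$$ for $\operatorname{Re}(q)>0$, $\operatorname{Re}(\upsilon)>0$, $\gamma_3,\gamma_4\notin\{0,-1,-2,\dots\}$, considered for $-\frac14<z<\frac14$; the same series is used when the parameter $q$ has real part $0$, with $1/\Gamma=0$ at poles of $\Gamma$. For $s>0$, $(ws)^{\upsilon l}$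 means $(w^{\upsilon})^l s^{\upsilon l}$ with a fixed choice of $w^\upsilon$ (and $w^{\upsilon}=0$ if $w=0$). The Riemann-Liouville fractional integral is ${}_{t}\mathbb{I}_{b^{+}}^{\sigma}[h](t)=\frac{1}{\Gamma(\sigma)}\int_b^t(t-y)^{\sigma-1}h(y)\,dy$ ($\operatorname{Re}\sigma>0$, $t>b$), and the Riemann-Liouville fractional derivative is ${}_{t}D_{b^{+}}^{\tau}[h]=\left(\frac{d}{dt}\right)^{m}{}_{t}\mathbb{I}_{b^{+}}^{m-\tau}[h]$ with $m=[\operatorname{Re}(\tau)]+1$, $[\cdot]$ being the integer part. *)

theory Defs
  imports "HOL-Analysis.Analysis"
begin

text \<open>
  \<open>W\<close> is one of the values of the multivalued power \<open>w\<^sup>\<upsilon>\<close>: some logarithm \<open>L\<close> of \<open>w\<close> is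
  fixed, without preferring the principal branch; \<open>0\<^sup>\<upsilon>\<close> is \<open>0\<close>.
\<close>
definition is_power_value :: "complex \<Rightarrow> complex \<Rightarrow> complex \<Rightarrow> bool" where
  "is_power_value w \<upsilon> W \<longleftrightarrow>
     (if w = 0 then W = 0 else (\<exists>L. exp L = w \<and> W = exp (\<upsilon> * L)))"

text \<open>
  The bivariate I-Konhauser Mittag-Leffler function at \<open>(z, w * s)\<close> for \<open>s > 0\<close>. The complex
  number \<open>w\<close> enters only through the chosen value \<open>W\<close> of \<open>w\<^sup>\<upsilon>\<close>, the power \<open>(w * s)\<^sup>\<upsilon>\<^sup>l\<close>
  being \<open>W\<^sup>l * s\<^sup>\<upsilon>\<^sup>l\<close>; the function of \<open>s\<close> itself is the case \<open>w = W = 1\<close>.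
  The factor \<open>rGamma\<close> is \<open>1 / Gamma\<close>, with the value \<open>0\<close> at the poles of \<open>Gamma\<close>.
\<close>
definition IK_Mittag_Leffler ::
  "complex \<Rightarrow> complex \<Rightarrow> complex \<Rightarrow> complex \<Rightarrow> complex \<Rightarrow> complex \<Rightarrow> complex \<Rightarrow> real \<Rightarrow> real \<Rightarrow> complex"
  where
  "IK_Mittag_Leffler \<gamma>1 \<gamma>2 \<gamma>3 \<gamma>4 q \<upsilon> W z s =
     (\<Sum>l. \<Sum>n. (-1) ^ n * pochhammer \<gamma>1 (2 * n) * pochhammer \<gamma>2 (l + n)
                 * of_real z ^ n * (W ^ l * of_real s powr (\<upsilon> * of_nat l))
               / (pochhammer \<gamma>3 n * pochhammer \<gamma>4 n * fact n * fact l)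
               * rGamma (q + \<upsilon> * of_nat l))"

definition RL_integrand :: "complex \<Rightarrow> (real \<Rightarrow> complex) \<Rightarrow> real \<Rightarrow> real \<Rightarrow> complex" where
  "RL_integrand \<sigma> h t y = of_real (t - y) powr (\<sigma> - 1) * h y"

definition RL_integral :: "real \<Rightarrow> complex \<Rightarrow> (real \<Rightarrow> complex) \<Rightarrow> real \<Rightarrow> complex" where
  "RL_integral b \<sigma> h t = 1 / Gamma \<sigma> * integral {b..t} (RL_integrand \<sigma> h t)"

abbreviation iterated_deriv :: "nat \<Rightarrow> (real \<Rightarrow> complex) \<Rightarrow> real \<Rightarrow> complex" where
  "iterated_deriv k f \<equiv> ((\<lambda>g x. vector_derivative g (at x)) ^^ k) f"

definition RL_order :: "complex \<Rightarrow> nat" where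
  "RL_order \<tau> = nat \<lfloor>Re \<tau>\<rfloor> + 1"

definition RL_derivative :: "real \<Rightarrow> complex \<Rightarrow> (real \<Rightarrow> complex) \<Rightarrow> real \<Rightarrow> complex" where
  "RL_derivative b \<tau> h t =
     iterated_deriv (RL_order \<tau>) (RL_integral b (of_nat (RL_order \<tau>) - \<tau>) h) t"

text \<open>
  Since \<^const>\<open>integral\<close> and \<^const>\<open>vector_derivative\<close> are total, existence of the
  fractional derivative on \<open>(b, \<infinity>)\<close> is a separate predicate: the fractional integral converges
  absolutely at every point, and it can be differentiated \<open>RL_order \<tau>\<close> times.
\<close>
definition RL_differentiable :: "real \<Rightarrow> complex \<Rightarrow> (real \<Rightarrow> complex) \<Rightarrow> bool" where
  "RL_differentiable b \<tau> h \<longleftrightarrow>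
     (let m = RL_order \<tau>; \<sigma> = of_nat m - \<tau> in
       (\<forall>x>b. RL_integrand \<sigma> h x absolutely_integrable_on {b..x}) \<and>
       (\<forall>k<m. \<forall>x>b. iterated_deriv k (RL_integral b \<sigma> h) differentiable (at x)))"

end

theory Submission
  imports Defs
begin

text \<open>
  The sum over \<open>n\<close> involves neither \<open>q\<close> nor the variable \<open>s = x - b\<close>. With
  \<open>c l = (\<Sum>n. \<dots>) * W ^ l\<close>, the function to be differentiated is
  \<open>G\<^sub>q s = (\<Sum>l. c l * s powr (q + \<upsilon> * l - 1) / Gamma (q + \<upsilon> * l))\<close>,
  and each power \<open>s powr (p - 1) / Gamma p\<close> behaves simply: the fractional integral of order
  \<open>\<sigma>\<close> replaces \<open>p\<close> by \<open>p + \<sigma>\<close>, by Euler's Beta integral, and the ordinary derivative replaces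
  \<open>p\<close> by \<open>p - 1\<close>, by the functional equation of \<open>Gamma\<close>. If both rules may be applied term by term,
  then integrating with \<open>\<sigma> = m - \<tau>\<close> and differentiating \<open>m\<close> times takes \<open>G\<^sub>q\<close> to
  \<open>G\<close> with index \<open>q + (m - \<tau>) - m = q - \<tau>\<close>.

  Two estimates justify the exchange of limits. First, \<open>c l\<close> grows at most geometrically
  (\<open>IK_coeff_bound\<close>); this is where \<open>\<bar>z\<bar> < 1/4\<close> enters, since the ratio of consecutive terms of the
  sum over \<open>n\<close> tends to \<open>- 4 * z\<close>. Secondly, \<open>1 / Gamma (q + \<upsilon> * l)\<close> decays faster than any
  geometric sequence. In place of Stirling's formula for complex arguments the proof uses
  \<open>Gamma p / Gamma (p + \<upsilon>) = Beta p \<upsilon> / Gamma \<upsilon>\<close>: along \<open>p = q + \<upsilon> * l\<close> the Beta integral tends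
  to \<open>0\<close> by dominated convergence (\<open>Beta_tendsto_zero\<close>), so consecutive quotients tend to \<open>0\<close>.

  Hence \<open>G\<^sub>q s = s powr (q - 1) * F\<^sub>q (s powr \<upsilon>)\<close> for an entire power series \<open>F\<^sub>q\<close>, which makes
  termwise differentiation a matter of power series (\<open>wright_fun_has_vector_derivative\<close>); the
  termwise integral rests on the summability of the integrals of the norms
  (\<open>RL_integral_wright_fun\<close>). The Beta integral with complex exponents
  (\<open>Beta_integral_complex\<close>) follows from Euler's integral for \<open>Gamma\<close> and Fubini's theorem.
\<close>

section \<open>Geometric growth of the coefficients\<close>

text \<open>
  The ratio test with the recurrence kept as a product, so that \<open>u\<close> may vanish; the
  conclusion measures by which geometric sequences \<open>u\<close> may be multiplied.
\<close>
lemma summable_of_ratio_limit: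
  fixes u r :: "nat \<Rightarrow> 'a::real_normed_field"
  assumes rec: "eventually (\<lambda>n. u (Suc n) = r n * u n) sequentially"
    and lim: "r \<longlonglongrightarrow> L" and "0 \<le> R" and "norm L * R < 1"
  shows "summable (\<lambda>n. norm (u n) * R ^ n)"
proof -
  obtain c where c: "norm L * R < c" "c < 1"
    using dense assms(4) by blast
  have "(\<lambda>n. norm (r n) * R) \<longlonglongrightarrow> norm L * R"
    by (intro tendsto_intros lim)
  hence "eventually (\<lambda>n. norm (r n) * R < c) sequentially"
    using c by (auto dest: order_tendstoD)
  with rec have "eventually (\<lambda>n. u (Suc n) = r n * u n \<and> norm (r n) * R < c) sequentially"
    by (rule eventually_conj)
  then obtain N where N: "\<And>n. n \<ge> N \<Longrightarrow> u (Suc n) = r n * u n"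
      "\<And>n. n \<ge> N \<Longrightarrow> norm (r n) * R < c"
    by (auto simp: eventually_at_top_linorder)
  show ?thesis
  proof (rule summable_ratio_test[OF c(2)])
    fix n assume n: "n \<ge> N"
    have "norm (u (Suc n)) * R ^ Suc n = (norm (r n) * R) * (norm (u n) * R ^ n)"
      using N(1)[OF n] by (simp add: norm_mult mult_ac)
    also have "\<dots> \<le> c * (norm (u n) * R ^ n)"
      using N(2)[OF n] \<open>0 \<le> R\<close> by (intro mult_right_mono) auto
    finally show "norm (norm (u (Suc n)) * R ^ Suc n) \<le> c * norm (norm (u n) * R ^ n)"
      using \<open>0 \<le> R\<close> by (simp add: abs_mult)
  qed
qed

lemma affine_ratio_tendsto:
  fixes a b k :: complex
  shows "(\<lambda>n. (a + k * of_nat n) / (b + of_nat n)) \<longlonglongrightarrow> k"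
proof -
  have "(\<lambda>n. (a * inverse (of_nat n) + k) / (b * inverse (of_nat n) + 1)) \<longlonglongrightarrow> (a * 0 + k) / (b * 0 + 1)"
    by (intro tendsto_intros lim_inverse_n) auto
  moreover have "eventually (\<lambda>n. (a * inverse (of_nat n) + k) / (b * inverse (of_nat n) + 1)
                   = (a + k * of_nat n) / (b + of_nat n)) sequentially"
    using eventually_gt_at_top[of 0]
  proof eventually_elim
    case (elim n)
    have "a * inverse (of_nat n) + k = (a + k * of_nat n) / of_nat n"
         "b * inverse (of_nat n) + 1 = (b + of_nat n) / of_nat n"
      using elim by (simp_all add: field_simps)
    thus ?case using elim by simp
  qed
  ultimately show ?thesis by (simp add: tendsto_cong)
qed

text \<open>
  One term of the binomial expansion of \<open>(\<rho> + (1 - \<rho>)) ^ (l + n) = 1\<close>. It separates \<open>l\<close>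
  from \<open>n\<close> at a cost in \<open>n\<close> that is close to \<open>1\<close> per step if \<open>\<rho>\<close> is; the cruder
  bound \<open>2 ^ (l + n)\<close> would lose half of the interval \<open>\<bar>z\<bar> < 1/4\<close>.
\<close>
lemma binomial_le_geometric:
  fixes \<rho> :: real
  assumes "0 < \<rho>" "\<rho> < 1"
  shows "of_nat ((l + n) choose n) \<le> (1 / \<rho>) ^ n * (1 / (1 - \<rho>)) ^ l"
proof -
  have "of_nat ((l + n) choose n) * \<rho> ^ n * (1 - \<rho>) ^ (l + n - n)
          \<le> (\<Sum>k\<le>l + n. of_nat ((l + n) choose k) * \<rho> ^ k * (1 - \<rho>) ^ (l + n - k))"
    by (rule member_le_sum) (use assms in auto)
  also have "\<dots> = (\<rho> + (1 - \<rho>)) ^ (l + n)"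
    by (subst binomial_ring) simp
  finally show ?thesis
    using assms by (simp add: field_simps)
qed

definition IK_coeff :: "complex \<Rightarrow> complex \<Rightarrow> complex \<Rightarrow> complex \<Rightarrow> real \<Rightarrow> nat \<Rightarrow> nat \<Rightarrow> complex" where
  "IK_coeff \<gamma>1 \<gamma>2 \<gamma>3 \<gamma>4 z l n =
     (-1) ^ n * pochhammer \<gamma>1 (2 * n) * pochhammer \<gamma>2 (l + n) * of_real z ^ n
       / (pochhammer \<gamma>3 n * pochhammer \<gamma>4 n * fact n * fact l)"

text \<open>
  The numerator gains two linear factors of slope \<open>2\<close> per step and the denominator two of
  slope \<open>1\<close>, so the ratio of consecutive terms tends to \<open>4 * R\<close>.
\<close>
lemma summable_pochhammer_ratio:
  fixes \<gamma>1 \<gamma>3 \<gamma>4 :: complex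
  assumes "0 \<le> R" "4 * R < 1"
  shows "summable (\<lambda>n. norm (pochhammer \<gamma>1 (2 * n) / (pochhammer \<gamma>3 n * pochhammer \<gamma>4 n)) * R ^ n)"
proof (rule summable_of_ratio_limit)
  let ?r = "\<lambda>n. ((\<gamma>1 + 2 * of_nat n) / (\<gamma>3 + of_nat n))
                * (((\<gamma>1 + 1) + 2 * of_nat n) / (\<gamma>4 + of_nat n))"
  show "?r \<longlonglongrightarrow> 2 * 2"
    by (intro tendsto_mult affine_ratio_tendsto)
  show "eventually (\<lambda>n. pochhammer \<gamma>1 (2 * Suc n) / (pochhammer \<gamma>3 (Suc n) * pochhammer \<gamma>4 (Suc n))
          = ?r n * (pochhammer \<gamma>1 (2 * n) / (pochhammer \<gamma>3 n * pochhammer \<gamma>4 n))) sequentially"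
    by (intro always_eventually allI) (simp add: pochhammer_Suc add_ac mult_ac)
qed (use assms in auto)

lemma pochhammer_over_fact_le_geometric:
  fixes \<gamma> :: complex
  assumes "0 < \<rho>" "\<rho> < 1"
  shows "\<exists>C\<ge>0. \<forall>k. norm (pochhammer \<gamma> k) \<le> C * fact k * (1 / \<rho>) ^ k"
proof -
  have "summable (\<lambda>k. norm (pochhammer \<gamma> k / fact k) * \<rho> ^ k)"
  proof (rule summable_of_ratio_limit)
    show "(\<lambda>k. (\<gamma> + 1 * of_nat k) / (1 + of_nat k)) \<longlonglongrightarrow> 1"
      by (rule affine_ratio_tendsto)
    show "eventually (\<lambda>k. pochhammer \<gamma> (Suc k) / fact (Suc k)
            = (\<gamma> + 1 * of_nat k) / (1 + of_nat k) * (pochhammer \<gamma> k / fact k)) sequentially"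
      by (intro always_eventually allI) (simp add: pochhammer_Suc mult_ac)
  qed (use assms in auto)
  hence "Bseq (\<lambda>k. norm (pochhammer \<gamma> k / fact k) * \<rho> ^ k)"
    by (intro convergent_imp_Bseq) (auto dest: summable_LIMSEQ_zero simp: convergent_def)
  then obtain C where C: "C > 0" "\<And>k. norm (norm (pochhammer \<gamma> k / fact k) * \<rho> ^ k) \<le> C"
    by (auto simp: Bseq_def)
  have "norm (pochhammer \<gamma> k) \<le> C * fact k * (1 / \<rho>) ^ k" for k
    using C(2)[of k] assms by (simp add: norm_mult norm_divide abs_mult field_simps)
  thus ?thesis using C(1) by (intro exI[of _ C]) auto
qed

text \<open>
  The only coupling between \<open>l\<close> and \<open>n\<close> is \<open>pochhammer \<gamma>2 (l + n) / (fact l * fact n)\<close>, which is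
  \<open>pochhammer \<gamma>2 (l + n) / fact (l + n)\<close> times a binomial coefficient. Each of these two factors
  costs at most \<open>1 / \<rho>\<close> per step in \<open>n\<close>, and what remains is summable in \<open>n\<close> as long as
  \<open>4 * \<bar>z\<bar> < \<rho>\<^sup>2\<close>.
\<close>
lemma IK_coeff_bound:
  assumes "\<bar>z\<bar> < 1/4"
  shows "(\<forall>l. summable (IK_coeff \<gamma>1 \<gamma>2 \<gamma>3 \<gamma>4 z l)) \<and>
         (\<exists>A K. \<forall>l. norm (\<Sum>n. IK_coeff \<gamma>1 \<gamma>2 \<gamma>3 \<gamma>4 z l n) \<le> A * K ^ l)"
proof -
  \<comment> \<open>The mean of \<open>1\<close> and \<open>4 * \<bar>z\<bar>\<close>; its square exceeds their product \<open>4 * \<bar>z\<bar>\<close>.\<close>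
  define \<rho> where "\<rho> = (1 + 4 * \<bar>z\<bar>) / 2"
  have \<rho>: "0 < \<rho>" "\<rho> < 1" using assms by (auto simp: \<rho>_def)
  have "4 * \<bar>z\<bar> < \<rho>\<^sup>2"
  proof -
    have "0 < (1 - 4 * \<bar>z\<bar>)\<^sup>2" using assms by simp
    thus ?thesis by (simp add: \<rho>_def power2_eq_square field_simps)
  qed
  hence R: "0 \<le> \<bar>z\<bar> / \<rho>\<^sup>2" "4 * (\<bar>z\<bar> / \<rho>\<^sup>2) < 1"
    using \<rho> by (auto simp: field_simps)
  define a where "a = (\<lambda>n. pochhammer \<gamma>1 (2 * n) / (pochhammer \<gamma>3 n * pochhammer \<gamma>4 n))"
  define B where "B = (\<lambda>n. norm (a n) * (\<bar>z\<bar> / \<rho>\<^sup>2) ^ n)"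
  have B: "summable B"
    unfolding B_def a_def by (rule summable_pochhammer_ratio[OF R])
  obtain C where C: "C \<ge> 0" "\<And>k. norm (pochhammer \<gamma>2 k) \<le> C * fact k * (1 / \<rho>) ^ k"
    using pochhammer_over_fact_le_geometric[OF \<rho>] by blast
  define K where "K = 1 / (\<rho> * (1 - \<rho>))"
  have le: "norm (IK_coeff \<gamma>1 \<gamma>2 \<gamma>3 \<gamma>4 z l n) \<le> C * K ^ l * B n" for l n
  proof -
    have "norm (IK_coeff \<gamma>1 \<gamma>2 \<gamma>3 \<gamma>4 z l n)
            = norm (a n) * \<bar>z\<bar> ^ n * (norm (pochhammer \<gamma>2 (l + n)) / (fact l * fact n))"
      by (simp add: IK_coeff_def a_def norm_mult norm_divide norm_power mult_ac)
    also have "\<dots> \<le> norm (a n) * \<bar>z\<bar> ^ n * (C * fact (l + n) * (1 / \<rho>) ^ (l + n) / (fact l * fact n))"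
      by (intro mult_left_mono divide_right_mono C) auto
    also have "C * fact (l + n) * (1 / \<rho>) ^ (l + n) / (fact l * fact n)
                 = C * (1 / \<rho>) ^ (l + n) * real ((l + n) choose n)"
      by (subst binomial_fact) (auto simp: mult_ac)
    also have "norm (a n) * \<bar>z\<bar> ^ n * \<dots>
                 \<le> norm (a n) * \<bar>z\<bar> ^ n * (C * (1 / \<rho>) ^ (l + n) * ((1 / \<rho>) ^ n * (1 / (1 - \<rho>)) ^ l))"
      using \<rho> C by (intro mult_left_mono binomial_le_geometric) auto
    also have "\<dots> = C * K ^ l * B n"
    proof -
      have K: "K ^ l = (1 / \<rho>) ^ l * (1 / (1 - \<rho>)) ^ l"
        by (simp add: K_def power_mult_distrib[symmetric])
      have "(\<bar>z\<bar> / \<rho>\<^sup>2) ^ n = \<bar>z\<bar> ^ n * (1 / \<rho>) ^ n * (1 / \<rho>) ^ n"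
        by (simp add: power_mult_distrib[symmetric] power2_eq_square)
      thus ?thesis
        by (simp only: B_def K power_add mult_ac)
    qed
    finally show ?thesis .
  qed
  have s: "summable (\<lambda>n. C * K ^ l * B n)" for l
    by (intro summable_mult B)
  have "norm (\<Sum>n. IK_coeff \<gamma>1 \<gamma>2 \<gamma>3 \<gamma>4 z l n) \<le> (C * suminf B) * K ^ l" for l
  proof -
    have "norm (\<Sum>n. IK_coeff \<gamma>1 \<gamma>2 \<gamma>3 \<gamma>4 z l n) \<le> (\<Sum>n. C * K ^ l * B n)"
      by (rule norm_suminf_le[OF le s])
    also have "\<dots> = (C * suminf B) * K ^ l"
      using B by (subst suminf_mult) auto
    finally show ?thesis .
  qed
  moreover have "summable (IK_coeff \<gamma>1 \<gamma>2 \<gamma>3 \<gamma>4 z l)" for l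
    by (rule summable_comparison_test'[OF s]) (rule le)
  ultimately show ?thesis by blast
qed

section \<open>The Beta integral with complex exponents\<close>

text \<open>
  The one-sided power, zero for \<open>t \<le> 0\<close>: Gamma and Beta integrals and the fractional
  integrals of powers then become integrals and convolutions over the whole line, with no
  domains of integration to transform.
\<close>
definition pos_powr :: "complex \<Rightarrow> real \<Rightarrow> complex" where
  "pos_powr a t = (if t > 0 then of_real t powr a else 0)"

lemma pos_powr_measurable [measurable]: "pos_powr a \<in> borel_measurable borel"
proof -
  have "(\<lambda>t. indicator {0<..} t *\<^sub>R (complex_of_real t powr a)) \<in> borel_measurable borel"
    by (intro borel_measurable_continuous_on_indicator) (auto intro!: continuous_intros)
  also have "(\<lambda>t. indicator {0<..} t *\<^sub>R (complex_of_real t powr a)) = pos_powr a"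
    by (auto simp: pos_powr_def fun_eq_iff indicator_def)
  finally show ?thesis .
qed

lemma norm_pos_powr: "norm (pos_powr a t) = (if t > 0 then t powr Re a else 0)"
  by (auto simp: pos_powr_def norm_powr_real_powr)

lemma of_real_norm_pos_powr: "of_real (norm (pos_powr a t)) = pos_powr (of_real (Re a)) t"
  by (subst norm_pos_powr) (simp add: pos_powr_def powr_of_real[symmetric])

lemma pos_powr_mult: "t > 0 \<Longrightarrow> pos_powr a t * pos_powr b t = pos_powr (a + b) t"
  by (simp add: pos_powr_def powr_add)

lemma pos_powr_scale: "u > 0 \<Longrightarrow> pos_powr a (u * t) = pos_powr a u * pos_powr a t"
  by (auto simp: pos_powr_def powr_times_real zero_less_mult_iff)

lemma not_nonpos_Int_if_Re_pos:
  fixes a :: complex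
  assumes "Re a > 0"
  shows "a \<notin> \<int>\<^sub>\<le>\<^sub>0"
  using assms by (auto elim!: nonpos_Ints_cases)

lemma Gamma_has_bochner_integral:
  assumes "Re a > 0"
  shows "has_bochner_integral lborel (\<lambda>t. pos_powr (a - 1) t * exp (- of_real t)) (Gamma a)"
proof -
  let ?f = "\<lambda>t. complex_of_real t powr (a - 1) / of_real (exp t)"
  have eq: "(\<lambda>t. indicator {0<..} t *\<^sub>R ?f t) = (\<lambda>t. pos_powr (a - 1) t * exp (- of_real t))"
    by (auto simp: pos_powr_def fun_eq_iff indicator_def exp_minus exp_of_real field_simps)
  have "set_integrable lebesgue {0<..} ?f"
    by (rule absolutely_integrable_Gamma_integral'[OF assms])
  hence "integrable (completion lborel) (\<lambda>t. pos_powr (a - 1) t * exp (- of_real t))"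
    by (simp add: set_integrable_def eq)
  hence I: "integrable lborel (\<lambda>t. pos_powr (a - 1) t * exp (- of_real t))"
    by (subst (asm) integrable_completion) simp_all
  hence S: "set_integrable lborel {0<..} ?f"
    by (simp add: set_integrable_def eq)
  have "(LINT t:{0<..}|lborel. ?f t) = integral {0<..} ?f"
    by (rule set_borel_integral_eq_integral(2)[OF S])
  also have "\<dots> = Gamma a"
    by (rule integral_unique[OF Gamma_integral_complex'[OF assms]])
  finally show ?thesis
    using I by (simp add: has_bochner_integral_iff set_lebesgue_integral_def eq)
qed

lemma integrable_Beta_kernel:
  assumes "Re a > 0" "Re b > 0"
  shows "integrable lborel (\<lambda>t. pos_powr (a - 1) t * pos_powr (b - 1) (1 - t))"
proof (rule Bochner_Integration.integrable_bound)
  show "integrable lborel (\<lambda>t. indicator {0..1} t *\<^sub>R (t powr (Re a - 1) * (1 - t) powr (Re b - 1)))"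
    using integrable_Beta[OF assms] by (simp add: set_integrable_def)
qed (auto simp: norm_mult norm_pos_powr indicator_def)

lemma Beta_kernel_scale:
  assumes "u > 0"
  shows "pos_powr (a - 1) (u * t) * pos_powr (b - 1) (u - u * t)
           = pos_powr (a + b - 2) u * (pos_powr (a - 1) t * pos_powr (b - 1) (1 - t))"
proof -
  have "pos_powr (b - 1) (u - u * t) = pos_powr (b - 1) (u * (1 - t))"
    by (simp add: algebra_simps)
  moreover have "pos_powr (a + b - 2) u = pos_powr (a - 1) u * pos_powr (b - 1) u"
    using assms by (subst pos_powr_mult) (simp_all add: algebra_simps)
  ultimately show ?thesis
    using assms by (simp add: pos_powr_scale)
qed

text \<open>
  The convolution of two one-sided powers is homogeneous, so its value at any \<open>u\<close> is that at \<open>1\<close>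
  times a power of \<open>u\<close>.
\<close>
lemma Beta_kernel_convolution_scale:
  assumes "Re a > 0" "Re b > 0"
  shows "has_bochner_integral lborel (\<lambda>t. pos_powr (a - 1) t * pos_powr (b - 1) (u - t))
           (pos_powr (a + b - 1) u * (\<integral>t. pos_powr (a - 1) t * pos_powr (b - 1) (1 - t) \<partial>lborel))"
proof (cases "u > 0")
  case False
  hence "(\<lambda>t. pos_powr (a - 1) t * pos_powr (b - 1) (u - t)) = (\<lambda>t. 0)"
    by (auto simp: pos_powr_def fun_eq_iff)
  with False show ?thesis by (simp add: pos_powr_def has_bochner_integral_zero)
next
  case True
  define I where "I = (\<integral>t. pos_powr (a - 1) t * pos_powr (b - 1) (1 - t) \<partial>lborel)"
  have "has_bochner_integral lborel (\<lambda>t. pos_powr (a - 1) (u * t) * pos_powr (b - 1) (u - u * t))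
          (pos_powr (a + b - 2) u * I)"
    unfolding Beta_kernel_scale[OF True] I_def
    by (intro has_bochner_integral_mult_right has_bochner_integral_integrable
          integrable_Beta_kernel assms)
  hence "has_bochner_integral lborel (\<lambda>t. pos_powr (a - 1) t * pos_powr (b - 1) (u - t))
          (u *\<^sub>R (pos_powr (a + b - 2) u * I))"
    using True by (subst lborel_has_bochner_integral_real_affine_iff[where c = u and t = 0]) auto
  also have "u *\<^sub>R (pos_powr (a + b - 2) u * I) = pos_powr (a + b - 1) u * I"
  proof -
    have "of_real u = pos_powr 1 u" using True by (simp add: pos_powr_def)
    hence "u *\<^sub>R (pos_powr (a + b - 2) u * I) = pos_powr 1 u * pos_powr (a + b - 2) u * I"
      by (simp add: scaleR_conv_of_real)
    thus ?thesis using True by (simp add: pos_powr_mult algebra_simps)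
  qed
  finally show ?thesis by (simp add: I_def)
qed

lemma exp_shift_has_bochner_integral:
  assumes "Re b > 0"
  shows "has_bochner_integral lborel (\<lambda>u. pos_powr (b - 1) (u - t) * exp (- of_real u))
           (exp (- of_real t) * Gamma b)"
proof -
  have "has_bochner_integral lborel
          (\<lambda>u. exp (- of_real t) * (pos_powr (b - 1) u * exp (- of_real u))) (exp (- of_real t) * Gamma b)"
    by (intro has_bochner_integral_mult_right Gamma_has_bochner_integral assms)
  also have "(\<lambda>u. exp (- of_real t) * (pos_powr (b - 1) u * exp (- of_real u)))
      = (\<lambda>u. pos_powr (b - 1) (t + 1 * u - t) * exp (- of_real (t + 1 * u)))"
  proof
    fix u :: real
    have "exp (- complex_of_real (t + 1 * u)) = exp (- of_real t) * exp (- of_real u)"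
      by (simp add: mult_exp_exp)
    thus "exp (- of_real t) * (pos_powr (b - 1) u * exp (- of_real u))
            = pos_powr (b - 1) (t + 1 * u - t) * exp (- complex_of_real (t + 1 * u))"
      by simp
  qed
  finally show ?thesis
    by (subst lborel_has_bochner_integral_real_affine_iff[where c = 1 and t = t]) auto
qed

text \<open>
  Write \<open>Gamma a * Gamma b\<close> as a double integral of
  \<open>pos_powr (a - 1) t * pos_powr (b - 1) (u - t) * exp (- u)\<close>. Integrating over \<open>u\<close> first gives the
  product of the two Gamma integrals. Integrating over \<open>t\<close> first gives, by homogeneity of the
  convolution, the Beta integral times \<open>Gamma (a + b)\<close>.
\<close>
lemma Beta_integral_complex:
  assumes a: "Re a > 0" and b: "Re b > 0"
  shows "(\<integral>t. pos_powr (a - 1) t * pos_powr (b - 1) (1 - t) \<partial>lborel) = Beta a b"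
proof -
  define I where "I = (\<integral>t. pos_powr (a - 1) t * pos_powr (b - 1) (1 - t) \<partial>lborel)"
  define F where "F = (\<lambda>t u. pos_powr (a - 1) t * (pos_powr (b - 1) (u - t) * exp (- of_real u)))"
  have meas: "case_prod F \<in> borel_measurable (lborel \<Otimes>\<^sub>M lborel)"
    unfolding F_def by measurable
  have inner: "has_bochner_integral lborel (F t)
                 (pos_powr (a - 1) t * exp (- of_real t) * Gamma b)" for t
    using has_bochner_integral_mult_right[OF exp_shift_has_bochner_integral[OF b, of t], of "pos_powr (a - 1) t"]
    by (simp add: F_def mult_ac)
  \<comment> \<open>The same integral with real exponents, computed in the complex numbers.\<close>
  have norm_inner: "(\<integral>u. norm (F t u) \<partial>lborel)
                      = norm (pos_powr (a - 1) t * exp (- of_real t)) * Gamma (Re b)" for t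
  proof -
    have "complex_of_real (\<integral>u. norm (F t u) \<partial>lborel) = (\<integral>u. of_real (norm (F t u)) \<partial>lborel)"
      by simp
    also have "\<dots> = (\<integral>u. of_real (norm (pos_powr (a - 1) t))
                        * (pos_powr (of_real (Re b) - 1) (u - t) * exp (- of_real u)) \<partial>lborel)"
      by (intro Bochner_Integration.integral_cong refl)
         (simp add: F_def norm_mult of_real_norm_pos_powr exp_of_real[symmetric])
    also have "\<dots> = of_real (norm (pos_powr (a - 1) t)) * (exp (- of_real t) * Gamma (of_real (Re b)))"
      using b by (intro has_bochner_integral_integral_eq has_bochner_integral_mult_right
            exp_shift_has_bochner_integral) auto
    also have "\<dots> = of_real (norm (pos_powr (a - 1) t * exp (- of_real t)) * Gamma (Re b))"
      by (simp add: norm_mult Gamma_complex_of_real exp_of_real[symmetric])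
    finally show ?thesis by (simp only: of_real_eq_iff)
  qed
  have int: "integrable (lborel \<Otimes>\<^sub>M lborel) (case_prod F)"
  proof (rule lborel_pair.Fubini_integrable[OF meas])
    show "integrable lborel (\<lambda>t. \<integral>u. norm (case_prod F (t, u)) \<partial>lborel)"
      using Gamma_has_bochner_integral[OF a]
      by (simp add: norm_inner has_bochner_integral_iff)
    show "AE t in lborel. integrable lborel (\<lambda>u. case_prod F (t, u))"
      using inner by (auto simp: has_bochner_integral_iff)
  qed
  have outer: "(\<integral>t. F t u \<partial>lborel) = pos_powr (a + b - 1) u * exp (- of_real u) * I" for u
  proof -
    have "has_bochner_integral lborel
            (\<lambda>t. (pos_powr (a - 1) t * pos_powr (b - 1) (u - t)) * exp (- of_real u))
            (pos_powr (a + b - 1) u * I * exp (- of_real u))"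
      unfolding I_def
      by (intro has_bochner_integral_mult_left Beta_kernel_convolution_scale a b)
    thus ?thesis
      by (simp add: F_def has_bochner_integral_iff mult_ac)
  qed
  have "Gamma a * Gamma b = (\<integral>t. (\<integral>u. F t u \<partial>lborel) \<partial>lborel)"
    using inner Gamma_has_bochner_integral[OF a]
    by (simp add: has_bochner_integral_iff)
  also have "\<dots> = (\<integral>u. (\<integral>t. F t u \<partial>lborel) \<partial>lborel)"
    using lborel_pair.Fubini_integral[OF int] by simp
  also have "\<dots> = Gamma (a + b) * I"
    using Gamma_has_bochner_integral[of "a + b"] a b by (simp add: outer has_bochner_integral_iff)
  finally have "Gamma a * Gamma b = Gamma (a + b) * I" .
  moreover have "a + b \<notin> \<int>\<^sub>\<le>\<^sub>0" using a b by (intro not_nonpos_Int_if_Re_pos) simp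
  ultimately show ?thesis
    by (simp add: I_def Beta_def Gamma_eq_zero_iff)
qed

text \<open>
  Up to the factor \<open>1 / Gamma \<sigma>\<close> this is the fractional integral of order \<open>\<sigma>\<close> of
  \<open>(y - b) powr (p - 1)\<close>, written as a convolution.
\<close>
lemma Riemann_Liouville_power_kernel:
  assumes "Re p > 0" "Re \<sigma> > 0"
  shows "has_bochner_integral lborel (\<lambda>y. pos_powr (\<sigma> - 1) (x - y) * pos_powr (p - 1) (y - b))
           (Beta p \<sigma> * pos_powr (p + \<sigma> - 1) (x - b))"
proof -
  have "has_bochner_integral lborel (\<lambda>t. pos_powr (p - 1) t * pos_powr (\<sigma> - 1) ((x - b) - t))
          (pos_powr (p + \<sigma> - 1) (x - b) * Beta p \<sigma>)"
    using Beta_kernel_convolution_scale[OF assms] by (simp add: Beta_integral_complex assms)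
  thus ?thesis
    by (subst lborel_has_bochner_integral_real_affine_iff[where c = 1 and t = b])
       (simp_all add: mult_ac algebra_simps)
qed

text \<open>
  In the Beta integral the exponent \<open>q + \<upsilon> * l - 1\<close> contributes the factor \<open>(t powr \<upsilon>) ^ l\<close>, which
  has norm below \<open>1\<close> and tends to \<open>0\<close> for every \<open>t\<close> strictly between \<open>0\<close> and \<open>1\<close>.
\<close>
lemma Beta_tendsto_zero:
  assumes q: "Re q > 0" and \<upsilon>: "Re \<upsilon> > 0"
  shows "(\<lambda>l. Beta (q + \<upsilon> * of_nat l) \<upsilon>) \<longlonglongrightarrow> 0"
proof -
  let ?f = "\<lambda>l t. pos_powr (q + \<upsilon> * of_nat l - 1) t * pos_powr (\<upsilon> - 1) (1 - t)"
  have "(\<lambda>l. \<integral>t. ?f l t \<partial>lborel) \<longlonglongrightarrow> (\<integral>t. 0 \<partial>(lborel :: real measure))"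
  proof (rule integral_dominated_convergence)
    show "integrable lborel (\<lambda>t. norm (pos_powr (q - 1) t * pos_powr (\<upsilon> - 1) (1 - t)))"
      by (intro integrable_norm integrable_Beta_kernel q \<upsilon>)
    show "AE t in lborel. norm (?f l t) \<le> norm (pos_powr (q - 1) t * pos_powr (\<upsilon> - 1) (1 - t))" for l
      using \<upsilon> by (intro AE_I2) (auto simp: norm_mult norm_pos_powr intro!: mult_right_mono powr_mono')
    show "AE t in lborel. (\<lambda>l. ?f l t) \<longlonglongrightarrow> 0"
    proof (rule AE_I2)
      fix t :: real
      show "(\<lambda>l. ?f l t) \<longlonglongrightarrow> 0"
      proof (cases "0 < t \<and> t < 1")
        case True
        have "norm (complex_of_real t powr \<upsilon>) < 1"
          using True \<upsilon> powr_less_mono2[of "Re \<upsilon>" t 1] by (simp add: norm_powr_real_powr)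
        hence "(\<lambda>l. (pos_powr (q - 1) t * pos_powr (\<upsilon> - 1) (1 - t)) * (complex_of_real t powr \<upsilon>) ^ l) \<longlonglongrightarrow>
                 (pos_powr (q - 1) t * pos_powr (\<upsilon> - 1) (1 - t)) * 0"
          by (intro tendsto_intros LIMSEQ_power_zero)
        moreover have "(complex_of_real t powr \<upsilon>) ^ l = pos_powr (\<upsilon> * of_nat l) t" for l
          using True by (simp add: pos_powr_def powr_def exp_of_nat_mult[symmetric] mult_ac)
        moreover have "pos_powr (q + \<upsilon> * of_nat l - 1) t = pos_powr (q - 1) t * pos_powr (\<upsilon> * of_nat l) t" for l
          using True by (simp add: pos_powr_mult algebra_simps)
        ultimately show ?thesis by (simp add: mult_ac)
      qed (auto simp: pos_powr_def)
    qed
  qed auto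
  moreover have "(\<integral>t. ?f l t \<partial>lborel) = Beta (q + \<upsilon> * of_nat l) \<upsilon>" for l
    using q \<upsilon> by (intro Beta_integral_complex) (auto intro: add_pos_nonneg)
  ultimately show ?thesis by simp
qed

text \<open>
  The super-geometric decay of \<open>rGamma\<close> along an arithmetic progression, in the form required by
  the ratio test. The index \<open>q\<close> is arbitrary: it drops to \<open>q - \<tau>\<close>, so the Beta integral is
  available only once \<open>q + \<upsilon> * l\<close> has reached the right half-plane.
\<close>
lemma rGamma_progression_ratio:
  assumes \<upsilon>: "Re \<upsilon> > 0"
  shows "eventually (\<lambda>l. rGamma (q + \<upsilon> * of_nat (Suc l))
           = Beta (q + \<upsilon> * of_nat l) \<upsilon> / Gamma \<upsilon> * rGamma (q + \<upsilon> * of_nat l)) sequentially"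
    and "(\<lambda>l. Beta (q + \<upsilon> * of_nat l) \<upsilon> / Gamma \<upsilon>) \<longlonglongrightarrow> 0"
proof -
  obtain N :: nat where N: "- Re q / Re \<upsilon> < real N"
    using reals_Archimedean2 by blast
  hence pos: "Re q + Re \<upsilon> * real N > 0" using \<upsilon> by (simp add: field_simps)
  have G: "Gamma \<upsilon> \<noteq> 0" using not_nonpos_Int_if_Re_pos[OF \<upsilon>] by (simp add: Gamma_eq_zero_iff)
  show "eventually (\<lambda>l. rGamma (q + \<upsilon> * of_nat (Suc l))
           = Beta (q + \<upsilon> * of_nat l) \<upsilon> / Gamma \<upsilon> * rGamma (q + \<upsilon> * of_nat l)) sequentially"
    using eventually_ge_at_top[of N]
  proof eventually_elim
    case (elim l)
    have "Re \<upsilon> * real N \<le> Re \<upsilon> * real l" using elim \<upsilon> by simp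
    hence "Re (q + \<upsilon> * of_nat l) > 0" using pos by simp
    hence "rGamma (q + \<upsilon> * of_nat l) \<noteq> 0"
      using not_nonpos_Int_if_Re_pos by (simp add: rGamma_eq_zero_iff)
    hence one: "Gamma (q + \<upsilon> * of_nat l) * rGamma (q + \<upsilon> * of_nat l) = 1"
      unfolding Gamma_def by (rule left_inverse)
    have "Beta (q + \<upsilon> * of_nat l) \<upsilon> / Gamma \<upsilon> * rGamma (q + \<upsilon> * of_nat l)
        = (Gamma (q + \<upsilon> * of_nat l) * rGamma (q + \<upsilon> * of_nat l)) * rGamma (q + \<upsilon> * of_nat l + \<upsilon>)"
      unfolding Beta_altdef using G by simp
    moreover have "q + \<upsilon> * of_nat (Suc l) = q + \<upsilon> * of_nat l + \<upsilon>"
      by (simp add: algebra_simps)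
    ultimately show ?case by (simp only: one mult_1_left)
  qed
  have "(\<lambda>l. Beta ((q + \<upsilon> * of_nat N) + \<upsilon> * of_nat l) \<upsilon>) \<longlonglongrightarrow> 0"
    by (rule Beta_tendsto_zero) (use pos \<upsilon> in auto)
  also have "(\<lambda>l. Beta ((q + \<upsilon> * of_nat N) + \<upsilon> * of_nat l) \<upsilon>) = (\<lambda>l. Beta (q + \<upsilon> * of_nat (l + N)) \<upsilon>)"
    by (simp add: algebra_simps)
  finally have "(\<lambda>l. Beta (q + \<upsilon> * of_nat l) \<upsilon>) \<longlonglongrightarrow> 0"
    by (rule LIMSEQ_offset)
  from tendsto_divide[OF this tendsto_const[of "Gamma \<upsilon>"] G]
  show "(\<lambda>l. Beta (q + \<upsilon> * of_nat l) \<upsilon> / Gamma \<upsilon>) \<longlonglongrightarrow> 0" by simp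
qed

section \<open>Fractional calculus of Wright-type series\<close>

text \<open>
  A power series of Wright type, entire if \<open>c\<close> grows at most geometrically; with \<open>c l = 1\<close> it is the two-parameter Mittag-Leffler
  function, with \<open>c l = 1 / fact l\<close> Wright's function. Using \<open>rGamma\<close> makes it meaningful for
  every index \<open>q\<close>.
\<close>
definition wright_series :: "(nat \<Rightarrow> complex) \<Rightarrow> complex \<Rightarrow> complex \<Rightarrow> complex \<Rightarrow> complex" where
  "wright_series c \<upsilon> q \<zeta> = (\<Sum>l. c l * rGamma (q + \<upsilon> * of_nat l) * \<zeta> ^ l)"

text \<open>
  Termwise this is the sum of the normalised powers \<open>s powr (q + \<upsilon> * l - 1) / Gamma (q + \<upsilon> * l)\<close>
  with weights \<open>c l\<close>; the factorisation confines all non-integer powers to two places.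
\<close>
definition wright_fun :: "(nat \<Rightarrow> complex) \<Rightarrow> complex \<Rightarrow> complex \<Rightarrow> complex \<Rightarrow> complex" where
  "wright_fun c \<upsilon> q s = s powr (q - 1) * wright_series c \<upsilon> q (s powr \<upsilon>)"

lemma of_real_powr_progression:
  assumes "s > 0"
  shows "complex_of_real s powr (a + \<upsilon> * of_nat l) = of_real s powr a * (of_real s powr \<upsilon>) ^ l"
  using assms by (simp add: powr_def exp_of_nat_mult[symmetric] exp_add[symmetric] algebra_simps)

context
  fixes c :: "nat \<Rightarrow> complex" and \<upsilon> :: complex and A K :: real
  assumes c_le: "\<And>l. norm (c l) \<le> A * K ^ l" and \<upsilon>: "Re \<upsilon> > 0"
begin

lemma wright_series_abs_summable:
  assumes "0 \<le> R"
  shows "summable (\<lambda>l. norm (c l * rGamma (q + \<upsilon> * of_nat l)) * R ^ l)"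
proof (rule summable_comparison_test')
  have "summable (\<lambda>l. norm (rGamma (q + \<upsilon> * of_nat l)) * (\<bar>K\<bar> * R) ^ l)"
    using assms by (intro summable_of_ratio_limit[OF rGamma_progression_ratio[OF \<upsilon>]]) auto
  thus "summable (\<lambda>l. \<bar>A\<bar> * (norm (rGamma (q + \<upsilon> * of_nat l)) * (\<bar>K\<bar> * R) ^ l))"
    by (rule summable_mult)
  fix l :: nat
  have "norm (c l) \<le> \<bar>A * K ^ l\<bar>" using c_le[of l] by linarith
  hence "norm (c l) \<le> \<bar>A\<bar> * \<bar>K\<bar> ^ l" by (simp add: abs_mult power_abs)
  hence "norm (c l) * (norm (rGamma (q + \<upsilon> * of_nat l)) * R ^ l)
           \<le> \<bar>A\<bar> * \<bar>K\<bar> ^ l * (norm (rGamma (q + \<upsilon> * of_nat l)) * R ^ l)"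
    using assms by (intro mult_right_mono) auto
  thus "norm (norm (c l * rGamma (q + \<upsilon> * of_nat l)) * R ^ l)
          \<le> \<bar>A\<bar> * (norm (rGamma (q + \<upsilon> * of_nat l)) * (\<bar>K\<bar> * R) ^ l)"
    using assms by (simp add: norm_mult abs_mult power_mult_distrib mult_ac)
qed

lemma wright_series_summable:
  "summable (\<lambda>l. c l * rGamma (q + \<upsilon> * of_nat l) * \<zeta> ^ l)"
proof (rule summable_norm_cancel)
  show "summable (\<lambda>l. norm (c l * rGamma (q + \<upsilon> * of_nat l) * \<zeta> ^ l))"
    using wright_series_abs_summable[of "norm \<zeta>" q] by (simp add: norm_mult norm_power)
qed

text \<open>
  The Euler-type operator \<open>(q - 1) + \<upsilon> * \<zeta> * d/d\<zeta>\<close> multiplies the \<open>l\<close>-th term by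
  \<open>q - 1 + \<upsilon> * l\<close>, and the functional equation of \<open>rGamma\<close> absorbs this factor by lowering \<open>q\<close>.
\<close>
lemma wright_series_deriv:
  obtains D where "(wright_series c \<upsilon> q has_field_derivative D) (at \<zeta>)"
    and "(q - 1) * wright_series c \<upsilon> q \<zeta> + \<upsilon> * \<zeta> * D = wright_series c \<upsilon> (q - 1) \<zeta>"
proof
  let ?a = "\<lambda>l. c l * rGamma (q + \<upsilon> * of_nat l)"
  let ?D = "\<Sum>l. diffs ?a l * \<zeta> ^ l"
  show "(wright_series c \<upsilon> q has_field_derivative ?D) (at \<zeta>)"
    unfolding wright_series_def
    by (rule termdiffs_strong_converges_everywhere) (rule wright_series_summable)
  have "(\<lambda>l. of_nat l * ?a l * \<zeta> ^ (l - Suc 0)) sums ?D"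
    by (intro diffs_equiv termdiff_converges_all wright_series_summable)
  hence "(\<lambda>l. \<upsilon> * \<zeta> * (of_nat l * ?a l * \<zeta> ^ (l - Suc 0))) sums (\<upsilon> * \<zeta> * ?D)"
    by (rule sums_mult)
  moreover have "\<upsilon> * \<zeta> * (of_nat l * ?a l * \<zeta> ^ (l - Suc 0)) = \<upsilon> * of_nat l * (?a l * \<zeta> ^ l)" for l
    by (cases l) (simp_all add: mult_ac)
  ultimately have "(\<lambda>l. \<upsilon> * of_nat l * (?a l * \<zeta> ^ l)) sums (\<upsilon> * \<zeta> * ?D)" by simp
  moreover have "(\<lambda>l. (q - 1) * (?a l * \<zeta> ^ l)) sums ((q - 1) * wright_series c \<upsilon> q \<zeta>)"
    unfolding wright_series_def by (intro sums_mult summable_sums wright_series_summable)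
  ultimately have "(\<lambda>l. (q - 1) * (?a l * \<zeta> ^ l) + \<upsilon> * of_nat l * (?a l * \<zeta> ^ l)) sums
                     ((q - 1) * wright_series c \<upsilon> q \<zeta> + \<upsilon> * \<zeta> * ?D)"
    by (intro sums_add)
  moreover have "(q - 1) * (?a l * \<zeta> ^ l) + \<upsilon> * of_nat l * (?a l * \<zeta> ^ l)
                   = c l * rGamma (q - 1 + \<upsilon> * of_nat l) * \<zeta> ^ l" for l
  proof -
    have "(q - 1 + \<upsilon> * of_nat l) * rGamma (q + \<upsilon> * of_nat l) = rGamma (q - 1 + \<upsilon> * of_nat l)"
      using rGamma_plus1[of "q - 1 + \<upsilon> * of_nat l"] by (simp add: algebra_simps)
    moreover have "(q - 1) * (?a l * \<zeta> ^ l) + \<upsilon> * of_nat l * (?a l * \<zeta> ^ l)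
        = c l * ((q - 1 + \<upsilon> * of_nat l) * rGamma (q + \<upsilon> * of_nat l)) * \<zeta> ^ l"
      by (simp add: algebra_simps)
    ultimately show ?thesis by (simp only:)
  qed
  ultimately show "(q - 1) * wright_series c \<upsilon> q \<zeta> + \<upsilon> * \<zeta> * ?D = wright_series c \<upsilon> (q - 1) \<zeta>"
    unfolding wright_series_def by (simp add: sums_iff)
qed

text \<open>
  By the chain rule, differentiating \<open>s powr (q - 1) * F (s powr \<upsilon>)\<close> yields
  \<open>s powr (q - 2)\<close> times the operator of the preceding lemma applied to \<open>F\<close>.
\<close>
lemma wright_fun_has_vector_derivative:
  assumes "x > b"
  shows "((\<lambda>x. wright_fun c \<upsilon> q (of_real (x - b))) has_vector_derivative
           wright_fun c \<upsilon> (q - 1) (of_real (x - b))) (at x)"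
proof -
  define s where "s = x - b"
  have s: "s > 0" using assms by (simp add: s_def)
  define \<zeta> where "\<zeta> = complex_of_real s powr \<upsilon>"
  obtain D where D: "(wright_series c \<upsilon> q has_field_derivative D) (at \<zeta>)"
    and D_eq: "(q - 1) * wright_series c \<upsilon> q \<zeta> + \<upsilon> * \<zeta> * D = wright_series c \<upsilon> (q - 1) \<zeta>"
    by (rule wright_series_deriv)
  have notin: "complex_of_real s \<notin> \<real>\<^sub>\<le>\<^sub>0" using s by (simp add: complex_nonpos_Reals_iff)
  have [simp]: "complex_of_real s \<noteq> 0" using s by simp
  have "((\<lambda>s. s powr \<upsilon>) has_field_derivative \<upsilon> * of_real s powr (\<upsilon> - 1)) (at (complex_of_real s))"
    by (rule has_field_derivative_powr[OF notin])
  hence d1: "((\<lambda>s. wright_series c \<upsilon> q (s powr \<upsilon>)) has_field_derivative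
           D * (\<upsilon> * of_real s powr (\<upsilon> - 1))) (at (complex_of_real s))"
    using D unfolding \<zeta>_def by (rule DERIV_chain2[rotated])
  have d2: "((\<lambda>s. s powr (q - 1)) has_field_derivative (q - 1) * of_real s powr (q - 1 - 1)) (at (complex_of_real s))"
    by (rule has_field_derivative_powr[OF notin])
  have "(wright_fun c \<upsilon> q has_field_derivative
           ((q - 1) * of_real s powr (q - 1 - 1) * wright_series c \<upsilon> q \<zeta>
             + D * (\<upsilon> * of_real s powr (\<upsilon> - 1)) * of_real s powr (q - 1))) (at (complex_of_real s))"
    using DERIV_mult[OF d2 d1] by (simp add: wright_fun_def[abs_def] \<zeta>_def)
  also have "(q - 1) * of_real s powr (q - 1 - 1) * wright_series c \<upsilon> q \<zeta>
               + D * (\<upsilon> * of_real s powr (\<upsilon> - 1)) * of_real s powr (q - 1)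
             = of_real s powr (q - 1 - 1) * ((q - 1) * wright_series c \<upsilon> q \<zeta> + \<upsilon> * \<zeta> * D)"
  proof -
    have "complex_of_real s powr (\<upsilon> - 1) * of_real s powr (q - 1) = of_real s powr (q - 1 - 1) * \<zeta>"
      unfolding \<zeta>_def by (simp only: powr_add[symmetric]) (simp add: algebra_simps)
    thus ?thesis by (simp add: algebra_simps)
  qed
  also have "\<dots> = wright_fun c \<upsilon> (q - 1) (of_real s)"
    by (simp only: D_eq wright_fun_def flip: \<zeta>_def)
  finally have "(wright_fun c \<upsilon> q has_field_derivative wright_fun c \<upsilon> (q - 1) (of_real s))
                  (at (complex_of_real s))" .
  hence "((\<lambda>s. wright_fun c \<upsilon> q (of_real s)) has_vector_derivative
           wright_fun c \<upsilon> (q - 1) (of_real s)) (at s)"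
    by (rule has_vector_derivative_real_field)
  moreover have "((\<lambda>x. x - b) has_vector_derivative 1) (at x)"
    by (auto intro!: derivative_eq_intros)
  ultimately have "((\<lambda>s. wright_fun c \<upsilon> q (of_real s)) \<circ> (\<lambda>x. x - b) has_vector_derivative
           1 *\<^sub>R wright_fun c \<upsilon> (q - 1) (of_real s)) (at x)"
    unfolding s_def by (intro vector_diff_chain_at)
  thus ?thesis by (simp add: o_def s_def)
qed

text \<open>
  The hypothesis concerns only points above \<open>b\<close>: fractional integrals are determined there,
  and derivatives on an open half-line see nothing else.
\<close>
lemma iterated_deriv_wright_fun:
  assumes f: "\<And>x. x > b \<Longrightarrow> f x = wright_fun c \<upsilon> q (of_real (x - b))" and "x > b"
  shows "iterated_deriv k f x = wright_fun c \<upsilon> (q - of_nat k) (of_real (x - b))"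
    and "iterated_deriv k f differentiable (at x)"
proof -
  have vd: "(g has_vector_derivative wright_fun c \<upsilon> (p - 1) (of_real (x - b))) (at x)"
    if "\<And>x. x > b \<Longrightarrow> g x = wright_fun c \<upsilon> p (of_real (x - b))" "x > b" for g p x
    by (rule has_vector_derivative_transform_within_open[OF wright_fun_has_vector_derivative[OF that(2)],
          where S = "{b<..}"]) (use that in auto)
  have eq: "iterated_deriv k f x = wright_fun c \<upsilon> (q - of_nat k) (of_real (x - b))" if "x > b" for x
    using that
  proof (induction k arbitrary: x)
    case 0
    thus ?case by (simp add: f)
  next
    case (Suc k)
    have "iterated_deriv (Suc k) f x = vector_derivative (iterated_deriv k f) (at x)" by simp
    also have "\<dots> = wright_fun c \<upsilon> (q - of_nat k - 1) (of_real (x - b))"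
      by (rule vector_derivative_at, rule vd) (use Suc in auto)
    finally show ?case by (simp add: algebra_simps)
  qed
  show "iterated_deriv k f x = wright_fun c \<upsilon> (q - of_nat k) (of_real (x - b))"
    by (rule eq[OF \<open>x > b\<close>])
  show "iterated_deriv k f differentiable (at x)"
    by (rule differentiableI_vector, rule vd[OF eq \<open>x > b\<close>])
qed

text \<open>
  On \<open>{b..x}\<close> the \<open>l\<close>-th power term is at most \<open>((x - b) powr Re \<upsilon>) ^ l\<close> times the
  integrable one with \<open>l = 0\<close>. With the absolute convergence of the series at every radius, this bounds the
  sum of the integrals of the norms, so the series may be integrated term by term. The Beta
  integral then turns \<open>rGamma (q + \<upsilon> * l)\<close> into \<open>Gamma \<sigma> * rGamma (q + \<sigma> + \<upsilon> * l)\<close>.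
\<close>
lemma RL_integral_wright_fun:
  assumes q: "Re q > 0" and \<sigma>: "Re \<sigma> > 0" and "x > b"
    and h: "\<And>y. y > b \<Longrightarrow> h y = wright_fun c \<upsilon> q (of_real (y - b))" "h b = 0"
  shows "RL_integrand \<sigma> h x absolutely_integrable_on {b..x}"
    and "RL_integral b \<sigma> h x = wright_fun c \<upsilon> (q + \<sigma>) (of_real (x - b))"
proof -
  let ?a = "\<lambda>l. c l * rGamma (q + \<upsilon> * of_nat l)"
  let ?k = "\<lambda>l y. pos_powr (\<sigma> - 1) (x - y) * pos_powr (q + \<upsilon> * of_nat l - 1) (y - b)"
  define I where "I = (\<lambda>y. indicator {b..x} y *\<^sub>R RL_integrand \<sigma> h x y)"
  define R where "R = (x - b) powr Re \<upsilon>"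
  have "R \<ge> 0" by (simp add: R_def)
  have Re_pos: "Re (q + \<upsilon> * of_nat l) > 0" for l
    using q \<upsilon> by (auto intro: add_pos_nonneg)
  have k_int: "has_bochner_integral lborel (?k l)
      (Beta (q + \<upsilon> * of_nat l) \<sigma> * pos_powr (q + \<upsilon> * of_nat l + \<sigma> - 1) (x - b))" for l
    by (rule Riemann_Liouville_power_kernel[OF Re_pos \<sigma>])
  have k0_int: "integrable lborel (\<lambda>y. norm (?k 0 y))"
    using k_int[of 0] by (intro integrable_norm) (simp add: has_bochner_integral_iff)
  have k_le: "norm (?k l y) \<le> R ^ l * norm (?k 0 y)" for l y
  proof (cases "b < y \<and> y < x")
    case True
    have "(y - b) powr (Re \<upsilon> * real l) \<le> (x - b) powr (Re \<upsilon> * real l)"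
      using True \<upsilon> by (intro powr_mono2) auto
    also have "\<dots> = R ^ l"
      using \<open>x > b\<close> by (simp add: R_def powr_powr[symmetric] powr_realpow)
    finally have "(y - b) powr (Re q - 1) * (y - b) powr (Re \<upsilon> * real l) \<le> (y - b) powr (Re q - 1) * R ^ l"
      by (intro mult_left_mono) auto
    also have "(y - b) powr (Re q - 1) * (y - b) powr (Re \<upsilon> * real l)
                 = (y - b) powr (Re (q + \<upsilon> * of_nat l) - 1)"
      by (simp add: powr_add[symmetric] algebra_simps)
    finally have "(x - y) powr (Re \<sigma> - 1) * (y - b) powr (Re (q + \<upsilon> * of_nat l) - 1)
        \<le> (x - y) powr (Re \<sigma> - 1) * ((y - b) powr (Re q - 1) * R ^ l)"
      by (intro mult_left_mono) auto
    thus ?thesis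
      using True by (simp add: norm_mult norm_pos_powr mult_ac)
  qed (auto simp: pos_powr_def)
  have sumR: "summable (\<lambda>l. norm (?a l) * R ^ l)"
    using \<open>R \<ge> 0\<close> by (rule wright_series_abs_summable)
  \<comment> \<open>The one-sided powers vanish off \<open>{b<..<x}\<close>, and so does \<open>I\<close>, since \<open>0 powr _ = 0\<close> at \<open>x\<close> and \<open>h b = 0\<close>.\<close>
  have I_eq: "I y = (\<Sum>l. ?a l * ?k l y)" for y
  proof (cases "b < y \<and> y < x")
    case True
    have "?a l * ?k l y = of_real (x - y) powr (\<sigma> - 1) * of_real (y - b) powr (q - 1)
                            * (?a l * (of_real (y - b) powr \<upsilon>) ^ l)" for l
      using True of_real_powr_progression[of "y - b" "q - 1" \<upsilon> l]
      by (simp add: pos_powr_def algebra_simps)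
    hence "(\<Sum>l. ?a l * ?k l y) = of_real (x - y) powr (\<sigma> - 1) * of_real (y - b) powr (q - 1)
             * wright_series c \<upsilon> q (of_real (y - b) powr \<upsilon>)"
      by (simp only: wright_series_def suminf_mult[OF wright_series_summable])
    with True show ?thesis
      by (simp add: I_def RL_integrand_def h wright_fun_def)
  next
    case False
    hence k_zero: "?k l y = 0" for l by (auto simp: pos_powr_def)
    have "I y = 0"
      using False \<open>x > b\<close> h by (auto simp: I_def RL_integrand_def indicator_def not_less)
    thus ?thesis by (simp only: k_zero mult_zero_right suminf_zero)
  qed
  have term_le: "norm (?a l * ?k l y) \<le> norm (?a l) * R ^ l * norm (?k 0 y)" for l y
  proof -
    have "norm (?a l * ?k l y) = norm (?a l) * norm (?k l y)" by (rule norm_mult)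
    also have "\<dots> \<le> norm (?a l) * (R ^ l * norm (?k 0 y))"
      by (intro mult_left_mono k_le) auto
    finally show ?thesis by (simp only: mult.assoc)
  qed
  have term_int: "integrable lborel (\<lambda>y. ?a l * ?k l y)" for l
    by (intro integrable_mult_right integrable.intros[OF k_int])
  have ae: "AE y in lborel. summable (\<lambda>l. norm (?a l * ?k l y))"
  proof (rule AE_I2)
    fix y
    show "summable (\<lambda>l. norm (?a l * ?k l y))"
      by (rule summable_comparison_test'[where g = "\<lambda>l. norm (?a l) * R ^ l * norm (?k 0 y)" and N = 0])
         (use term_le in \<open>simp_all only: real_norm_def abs_norm_cancel summable_mult2[OF sumR]\<close>)
  qed
  have norms: "summable (\<lambda>l. \<integral>y. norm (?a l * ?k l y) \<partial>lborel)"
  proof (rule summable_comparison_test'[where N = 0])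
    show "summable (\<lambda>l. norm (?a l) * R ^ l * (\<integral>y. norm (?k 0 y) \<partial>lborel))"
      by (intro summable_mult2 sumR)
    fix l
    have "(\<integral>y. norm (?a l * ?k l y) \<partial>lborel) \<le> (\<integral>y. norm (?a l) * R ^ l * norm (?k 0 y) \<partial>lborel)"
      by (intro integral_mono integrable_norm term_int integrable_mult_right k0_int term_le)
    thus "norm (\<integral>y. norm (?a l * ?k l y) \<partial>lborel) \<le> norm (?a l) * R ^ l * (\<integral>y. norm (?k 0 y) \<partial>lborel)"
      by simp
  qed
  have I_int: "integrable lborel I"
    using integrable_suminf[OF term_int ae norms] by (simp add: I_eq[abs_def])
  have I_sums: "(\<lambda>l. \<integral>y. ?a l * ?k l y \<partial>lborel) sums (\<integral>y. I y \<partial>lborel)"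
    using sums_integral[OF term_int ae norms] by (simp add: I_eq[abs_def])
  have term_val: "(\<integral>y. ?a l * ?k l y \<partial>lborel) = (Gamma \<sigma> * of_real (x - b) powr (q + \<sigma> - 1))
          * (c l * rGamma (q + \<sigma> + \<upsilon> * of_nat l) * (of_real (x - b) powr \<upsilon>) ^ l)" for l
  proof -
    have "rGamma (q + \<upsilon> * of_nat l) * Gamma (q + \<upsilon> * of_nat l) = 1"
      using not_nonpos_Int_if_Re_pos[OF Re_pos[of l]] by (simp add: Gamma_def rGamma_eq_zero_iff)
    hence "rGamma (q + \<upsilon> * of_nat l) * Beta (q + \<upsilon> * of_nat l) \<sigma> = Gamma \<sigma> * rGamma (q + \<upsilon> * of_nat l + \<sigma>)"
      by (simp add: Beta_altdef mult.assoc[symmetric])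
    moreover have "pos_powr (q + \<upsilon> * of_nat l + \<sigma> - 1) (x - b)
                     = of_real (x - b) powr (q + \<sigma> - 1) * (of_real (x - b) powr \<upsilon>) ^ l"
      using \<open>x > b\<close> of_real_powr_progression[of "x - b" "q + \<sigma> - 1" \<upsilon> l]
      by (simp add: pos_powr_def algebra_simps)
    moreover have "(\<integral>y. ?a l * ?k l y \<partial>lborel)
        = c l * (rGamma (q + \<upsilon> * of_nat l) * Beta (q + \<upsilon> * of_nat l) \<sigma>)
            * pos_powr (q + \<upsilon> * of_nat l + \<sigma> - 1) (x - b)"
      using has_bochner_integral_integral_eq[OF has_bochner_integral_mult_right[OF k_int[of l], of "?a l"]]
      by (simp only: mult.assoc)
    moreover have "q + \<upsilon> * of_nat l + \<sigma> = q + \<sigma> + \<upsilon> * of_nat l" by simp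
    ultimately show ?thesis by (simp only: mult_ac)
  qed
  have "(\<integral>y. I y \<partial>lborel) = (\<Sum>l. (Gamma \<sigma> * of_real (x - b) powr (q + \<sigma> - 1))
          * (c l * rGamma (q + \<sigma> + \<upsilon> * of_nat l) * (of_real (x - b) powr \<upsilon>) ^ l))"
    using sums_unique[OF I_sums] unfolding term_val .
  also have "\<dots> = Gamma \<sigma> * wright_fun c \<upsilon> (q + \<sigma>) (of_real (x - b))"
    by (subst suminf_mult[OF wright_series_summable]) (simp add: wright_fun_def wright_series_def)
  finally have I_val: "(\<integral>y. I y \<partial>lborel) = Gamma \<sigma> * wright_fun c \<upsilon> (q + \<sigma>) (of_real (x - b))" .
  have S: "set_integrable lborel {b..x} (RL_integrand \<sigma> h x)"
    using I_int by (simp add: set_integrable_def I_def)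
  have "I \<in> borel_measurable lborel" using I_int by auto
  with I_int have "integrable lebesgue I" by (simp add: integrable_completion)
  thus "RL_integrand \<sigma> h x absolutely_integrable_on {b..x}"
    by (simp add: set_integrable_def I_def)
  have "integral {b..x} (RL_integrand \<sigma> h x) = (\<integral>y. I y \<partial>lborel)"
    using set_borel_integral_eq_integral(2)[OF S] by (simp add: set_lebesgue_integral_def I_def)
  moreover have "Gamma \<sigma> \<noteq> 0" using not_nonpos_Int_if_Re_pos[OF \<sigma>] by (simp add: Gamma_eq_zero_iff)
  ultimately show "RL_integral b \<sigma> h x = wright_fun c \<upsilon> (q + \<sigma>) (of_real (x - b))"
    by (simp add: RL_integral_def I_val)
qed

lemma RL_derivative_wright_fun:
  assumes q: "Re q > 0" and \<tau>: "Re \<tau> \<ge> 0"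
    and h: "\<And>y. y > b \<Longrightarrow> h y = wright_fun c \<upsilon> q (of_real (y - b))" "h b = 0"
  shows "RL_differentiable b \<tau> h"
    and "x > b \<Longrightarrow> RL_derivative b \<tau> h x = wright_fun c \<upsilon> (q - \<tau>) (of_real (x - b))"
proof -
  define m where "m = RL_order \<tau>"
  define \<sigma> where "\<sigma> = of_nat m - \<tau>"
  have "Re \<tau> < real m"
    unfolding m_def RL_order_def using \<tau> by linarith
  hence \<sigma>: "Re \<sigma> > 0" by (simp add: \<sigma>_def)
  note I = RL_integral_wright_fun[OF q \<sigma> _ h]
  note D = iterated_deriv_wright_fun[of b "RL_integral b \<sigma> h" "q + \<sigma>", OF I(2)]
  show "RL_differentiable b \<tau> h"
    unfolding RL_differentiable_def Let_def m_def[symmetric] \<sigma>_def[symmetric]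
    using I(1) D(2) by auto
  show "RL_derivative b \<tau> h x = wright_fun c \<upsilon> (q - \<tau>) (of_real (x - b))" if "x > b"
    using D(1)[OF _ _ that, of m] by (simp add: RL_derivative_def m_def[symmetric] \<sigma>_def algebra_simps)
qed

end

section \<open>The bivariate I-Konhauser Mittag-Leffler function\<close>

text \<open>
  Summability over \<open>n\<close> allows all factors that depend on \<open>l\<close> alone to be taken out of the inner sum.
\<close>
lemma IK_Mittag_Leffler_eq_wright_series:
  assumes "Re \<upsilon> > 0" "\<bar>z\<bar> < 1/4" "s > 0"
  shows "IK_Mittag_Leffler \<gamma>1 \<gamma>2 \<gamma>3 \<gamma>4 q \<upsilon> W z s
           = wright_series (\<lambda>l. (\<Sum>n. IK_coeff \<gamma>1 \<gamma>2 \<gamma>3 \<gamma>4 z l n) * W ^ l) \<upsilon> q (of_real s powr \<upsilon>)"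
proof -
  have "(\<Sum>n. (-1) ^ n * pochhammer \<gamma>1 (2 * n) * pochhammer \<gamma>2 (l + n)
                 * of_real z ^ n * (W ^ l * of_real s powr (\<upsilon> * of_nat l))
               / (pochhammer \<gamma>3 n * pochhammer \<gamma>4 n * fact n * fact l)
               * rGamma (q + \<upsilon> * of_nat l))
          = (\<Sum>n. IK_coeff \<gamma>1 \<gamma>2 \<gamma>3 \<gamma>4 z l n) * W ^ l * rGamma (q + \<upsilon> * of_nat l) * (of_real s powr \<upsilon>) ^ l" for l
  proof -
    have "complex_of_real s powr (\<upsilon> * of_nat l) = (of_real s powr \<upsilon>) ^ l"
      using of_real_powr_progression[OF \<open>s > 0\<close>, of 0 \<upsilon> l] \<open>s > 0\<close> by simp
    hence "(\<Sum>n. (-1) ^ n * pochhammer \<gamma>1 (2 * n) * pochhammer \<gamma>2 (l + n)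
                 * of_real z ^ n * (W ^ l * of_real s powr (\<upsilon> * of_nat l))
               / (pochhammer \<gamma>3 n * pochhammer \<gamma>4 n * fact n * fact l)
               * rGamma (q + \<upsilon> * of_nat l))
        = (\<Sum>n. IK_coeff \<gamma>1 \<gamma>2 \<gamma>3 \<gamma>4 z l n * (W ^ l * rGamma (q + \<upsilon> * of_nat l) * (of_real s powr \<upsilon>) ^ l))"
      by (intro suminf_cong) (simp add: IK_coeff_def mult_ac)
    also have "\<dots> = (\<Sum>n. IK_coeff \<gamma>1 \<gamma>2 \<gamma>3 \<gamma>4 z l n) * (W ^ l * rGamma (q + \<upsilon> * of_nat l) * (of_real s powr \<upsilon>) ^ l)"
      using IK_coeff_bound[OF assms(2)] by (intro suminf_mult2[symmetric]) blast
    finally show ?thesis by (simp only: mult.assoc)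
  qed
  thus ?thesis
    by (simp add: IK_Mittag_Leffler_def wright_series_def)
qed

theorem theorem22:
  fixes q \<upsilon> \<gamma>1 \<gamma>2 \<gamma>3 \<gamma>4 \<tau> w W :: complex and b t z :: real
  assumes "Re q > 0" and "Re \<upsilon> > 0"
    and "\<gamma>3 \<notin> \<int>\<^sub>\<le>\<^sub>0" and "\<gamma>4 \<notin> \<int>\<^sub>\<le>\<^sub>0"
    and "Re \<tau> \<ge> 0" and "Re (q - \<tau>) \<ge> 0"
    and "is_power_value w \<upsilon> W"
    and "t > b" and "- (1/4) < z" and "z < 1/4"
  defines "h \<equiv> (\<lambda>x. of_real (x - b) powr (q - 1)
                      * IK_Mittag_Leffler \<gamma>1 \<gamma>2 \<gamma>3 \<gamma>4 q \<upsilon> W z (x - b))"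
  shows "RL_differentiable b \<tau> h \<and>
         RL_derivative b \<tau> h t =
           of_real (t - b) powr (q - \<tau> - 1)
             * IK_Mittag_Leffler \<gamma>1 \<gamma>2 \<gamma>3 \<gamma>4 (q - \<tau>) \<upsilon> W z (t - b)"
proof -
  have z: "\<bar>z\<bar> < 1/4" using assms by auto
  define c where "c = (\<lambda>l. (\<Sum>n. IK_coeff \<gamma>1 \<gamma>2 \<gamma>3 \<gamma>4 z l n) * W ^ l)"
  obtain A K where AK: "\<And>l. norm (\<Sum>n. IK_coeff \<gamma>1 \<gamma>2 \<gamma>3 \<gamma>4 z l n) \<le> A * K ^ l"
    using IK_coeff_bound[OF z, of \<gamma>1 \<gamma>2 \<gamma>3 \<gamma>4] by blast
  have c: "norm (c l) \<le> A * (K * norm W) ^ l" for l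
    using mult_right_mono[OF AK[of l], of "norm W ^ l"]
    by (simp add: c_def norm_mult norm_power power_mult_distrib mult_ac)
  have eq: "of_real (x - b) powr (p - 1) * IK_Mittag_Leffler \<gamma>1 \<gamma>2 \<gamma>3 \<gamma>4 p \<upsilon> W z (x - b)
              = wright_fun c \<upsilon> p (of_real (x - b))" if "x > b" for x p
    using IK_Mittag_Leffler_eq_wright_series[OF \<open>Re \<upsilon> > 0\<close> z, of "x - b"] that
    by (simp add: wright_fun_def c_def)
  \<comment> \<open>At \<open>b\<close> the prefactor is \<open>0 powr (q - 1) = 0\<close>.\<close>
  have h: "\<And>y. y > b \<Longrightarrow> h y = wright_fun c \<upsilon> q (of_real (y - b))" "h b = 0"
    by (simp_all only: h_def eq) simp
  show ?thesis
    unfolding eq[OF \<open>t > b\<close>]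
    using RL_derivative_wright_fun[OF c \<open>Re \<upsilon> > 0\<close> \<open>Re q > 0\<close> \<open>Re \<tau> \<ge> 0\<close> h] \<open>t > b\<close>
    by blast
qed

end
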